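(* Consider the three-dimensional curvilinear DGSEM semi-discretization (given in the context) of the compressible Euler equations with gravity for the set of conserved variables $(\varrho,\varrho\vec V,\varrho\theta)$. The numerical non-conservative surface and volume fluxes and numerical conservative surface and volume fluxes are total energy-conservative (TEC) if (i) the numerical density flux and the non-conservative fluxes are of the form $$\vec f^{\varrho,*}=\vec f^{\varrho,\mathrm{vol}}=\overline\varrho\,\{\!\{\vec V\}\!\},\qquad \vec g^{\varrho\vec V,*}=\vec g^{\varrho\vec V,\mathrm{vol}}=\overline\varrho\,[\![\phi]\!];$$ (ii) and the volume and the surface fluxes $f^{\mathrm{vol}}$, $f^*$ are of the TEC form or of the ETEC form (defined in the context).
   Context: Equations: $\partial_t\varrho+\nabla\cdot(\varrho\vec V)=0$, $\partial_t(\varrho\vec V)+\nabla\cdot(\varrho\vec V\otimes\vec V)+\nabla p+\varrho\nabla\phi=0$, $\partial_t(\varrho\theta)+\nabla\cdot(\varrho\theta\vec V)=0$, $\vec V=(v_1,v_2,v_3)$, $\varrho,\theta>0$, $p=K(\varrho\theta)^\gamma$, constants $K>0,\gamma>1$, time-independent geopotential $\phi(x,y,z)$. For an ordered pair of nodes with values $a_-$ (first) and $a_+$ (second): $\{\!\{a\}\!\}=(a_-+a_+)/2$, $[\![a]\!]=a_+-a_-$, $\{\!\{a\}\!\}_{\log}=[\![a]\!]/[\![\log a]\!]$, $\{\!\{a\}\!\}_\gamma=\frac{\gamma-1}\gamma\frac{[\![a^\gamma]\!]}{[\![a^{\gamma-1}]\!]}$ (the last two equal $a$ if $a_\pm=a$).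 $\overline\varrho$ is a symmetric, consistent two-point mean value of the density ($\overline\varrho=\varrho$ if both densities equal $\varrho$), the same in the density flux and in the non-conservative flux. Two-point fluxes in the Cartesian directions $d=1,2,3$: the TEC form is $f^d_\varrho$ = any consistent and symmetric flux of $\varrho v_d$, $f^d_{\varrho v_c}=f^d_\varrho\{\!\{v_c\}\!\}+\delta_{cd}\{\!\{p\}\!\}$ ($c=1,2,3$), $f^d_{\varrho\theta}=\{\!\{\varrho\theta\}\!\}_\gamma\{\!\{v_d\}\!\}$; the ETEC form is the same with $f^d_\varrho=f^d_{\varrho\theta}\{\!\{1/\theta\}\!\}_{\log}$. The two-point non-conservative term in direction $d$ has momentum component $c$ equal to $\delta_{cd}\,\overline\varrho\,[\![\phi]\!]$ and zero mass and potential-temperature components. Write $\overset{\leftrightarrow}{f}=(f^1,f^2,f^3)$, $\overset{\leftrightarrow}{g}=(g^1,g^2,g^3)$; for a vector $\vec a$, $\overset{\leftrightarrow}{f}\cdot\vec a=\sum_da_df^d$. DGSEM: on each curvilinear hexahedral element mapped from $[-1,1]^3$, with tensor-product Lobatto–Gauss–Legendre nodes $(i,j,k)\in\{0,\dots,N\}^3$, 1D weights $\omega_i$, $\omega_{ij}=\omega_i\omega_j$, $\omega_{ijk}=\omega_i\omega_j\omega_k$, Lagrange derivative matrix $D_{ij}=l_j'(\xi_i)$, $Q_{ij}=\omega_iD_{ij}$ (so $Q+Q^T=\mathrm{diag}(-1,0,\dots,0,1)$), mapping Jacobian $J_{ijk}$ and contravariant metric vectors $J\vec a^1,J\vec a^2,J\vec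 a^3$ at the nodes, the scheme is $J_{ijk}\omega_{ijk}\dot u_{ijk}=\mathcal F^1_{ijk}+\mathcal F^2_{ijk}+\mathcal F^3_{ijk}$ with $$\mathcal F^1_{ijk}=\omega_{jk}\Big(-2\sum_mQ_{im}\tilde f^{1,\mathrm{vol}}_{(i,m)jk}-\sum_mQ_{im}\tilde g^{1,\mathrm{vol}}_{(i,m)jk}-\delta_{i0}[\overset{\leftrightarrow}f\cdot J\vec a^1]_{0jk}+\delta_{iN}[\overset{\leftrightarrow}f\cdot J\vec a^1]_{Njk}+\delta_{i0}[\tilde f^*_{(0,L)jk}+\tfrac12\tilde g^*_{(0,L)jk}]-\delta_{iN}[\tilde f^*_{(N,R)jk}+\tfrac12\tilde g^*_{(N,R)jk}]\Big),$$ and $\mathcal F^2,\mathcal F^3$ defined analogously in the second index (with $\omega_{ik}$, $J\vec a^2$) and third index (with $\omega_{ij}$, $J\vec a^3$). Here $\tilde f^{1,\mathrm{vol}}_{(i,m)jk}=\overset{\leftrightarrow}f{}^{\mathrm{vol}}(u_{ijk},u_{mjk})\cdot\{\!\{J\vec a^1\}\!\}_{(i,m)jk}$, $\tilde g^{1,\mathrm{vol}}_{(i,m)jk}=\overset{\leftrightarrow}g{}^{\mathrm{vol}}(u_{ijk},u_{mjk})\cdot\{\!\{J\vec a^1\}\!\}_{(i,m)jk}$ (with jump $\phi_{mjk}-\phi_{ijk}$), the starred surface quantities are defined by the same formulas with $f^*,g^*$, and $L$, $R$ denote the neighbouring node in the adjacent element at the lower/upper face (jump = neighbour minus own). TEC: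 the semi-discretization conserves the total energy including the potential energy, $U=\frac p{\gamma-1}+\frac12\varrho\|\vec V\|^2+\varrho\phi$; that is, contracting the scheme with the associated entropy variables $U'$ and summing over the nodes of an element, the rate of change $\sum_{i,j,k}J_{ijk}\omega_{ijk}\dot U_{ijk}$ reduces to a conservative form, consisting only of differences of numerical total energy fluxes at the element interfaces.
   Formalization: The formal theorem additionally assumes that the contravariant metric vectors satisfy the discrete metric identities and that face-normal metric vectors agree from both sides of each interface; without these, nonconservative terms involving pV remain and the claim fails. *)

theory Defs
  imports "HOL-Analysis.Analysis" "HOL-Computational_Algebra.Polynomial"
begin

section \<open>States\<close>

text \<open>A state lists the conserved variables: density, momentum, and density times potential
  temperature.  A nodal value is a state together with the geopotential at the node.\<close>

type_synonym state = "real \<times> (real^3) \<times> real"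
type_synonym nodal = "state \<times> real"

definition dens :: "state \<Rightarrow> real" where "dens u = fst u"
definition mom :: "state \<Rightarrow> real^3" where "mom u = fst (snd u)"
definition rhotheta :: "state \<Rightarrow> real" where "rhotheta u = snd (snd u)"

definition vel :: "state \<Rightarrow> real^3" where "vel u = mom u /\<^sub>R dens u"
definition theta :: "state \<Rightarrow> real" where "theta u = rhotheta u / dens u"

definition admissible :: "state \<Rightarrow> bool" where
  "admissible u \<longleftrightarrow> dens u > 0 \<and> theta u > 0"

definition pressure :: "real \<Rightarrow> real \<Rightarrow> state \<Rightarrow> real" where
  "pressure K \<gamma> u = K * rhotheta u powr \<gamma>"

definition physical_flux :: "real \<Rightarrow> real \<Rightarrow> 3 \<Rightarrow> state \<Rightarrow> state" where
  "physical_flux K \<gamma> d u =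
     (dens u * vel u $ d,
      (dens u * vel u $ d) *\<^sub>R vel u + axis d (pressure K \<gamma> u),
      rhotheta u * vel u $ d)"

definition total_energy :: "real \<Rightarrow> real \<Rightarrow> real \<Rightarrow> state \<Rightarrow> real" where
  "total_energy K \<gamma> \<phi> u =
     pressure K \<gamma> u / (\<gamma> - 1) + dens u * (norm (vel u))\<^sup>2 / 2 + dens u * \<phi>"

text \<open>The gradient of the total energy with respect to the conserved variables, at fixed
  geopotential.\<close>

definition entropy_vars :: "real \<Rightarrow> real \<Rightarrow> real \<Rightarrow> state \<Rightarrow> state" where
  "entropy_vars K \<gamma> \<phi> u = (THE w. GDERIV (total_energy K \<gamma> \<phi>) u :> w)"


section \<open>Means and two-point fluxes\<close>

definition avg :: "'a::real_vector \<Rightarrow> 'a \<Rightarrow> 'a" where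
  "avg a b = (1/2) *\<^sub>R (a + b)"

definition log_mean :: "real \<Rightarrow> real \<Rightarrow> real" where
  "log_mean a b = (if a = b then a else (b - a) / (ln b - ln a))"

definition gamma_mean :: "real \<Rightarrow> real \<Rightarrow> real \<Rightarrow> real" where
  "gamma_mean \<gamma> a b =
     (if a = b then a
      else (\<gamma> - 1) / \<gamma> * ((b powr \<gamma> - a powr \<gamma>) / (b powr (\<gamma> - 1) - a powr (\<gamma> - 1))))"

text \<open>Two-point fluxes in the three Cartesian directions.  The non-conservative ones also see the
  geopotentials.  The first node is the own node, i.e. jumps are second minus first.\<close>

type_synonym flux = "3 \<Rightarrow> state \<Rightarrow> state \<Rightarrow> state"
type_synonym noncons_flux = "3 \<Rightarrow> nodal \<Rightarrow> nodal \<Rightarrow> state"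

text \<open>The mean may depend on the complete states, and consistency is required only when both states
  agree.  A mean of the two densities alone is a special case; it would not suffice for the ETEC
  form, whose density flux is \<open>{{\<rho>\<theta>}}\<^sub>\<gamma> {{1/\<theta>}}\<^sub>l\<^sub>o\<^sub>g {{v\<^sub>d}}\<close>, because
  \<open>{{\<rho>\<theta>}}\<^sub>\<gamma> {{1/\<theta>}}\<^sub>l\<^sub>o\<^sub>g\<close> need not equal \<open>\<rho>\<close> if only the densities agree.\<close>

definition density_mean :: "(state \<Rightarrow> state \<Rightarrow> real) \<Rightarrow> bool" where
  "density_mean rbar \<longleftrightarrow>
     (\<forall>a b. admissible a \<longrightarrow> admissible b \<longrightarrow> rbar a b = rbar b a) \<and>
     (\<forall>a. admissible a \<longrightarrow> rbar a a = dens a)"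

definition tec_form :: "real \<Rightarrow> real \<Rightarrow> flux \<Rightarrow> bool" where
  "tec_form K \<gamma> f \<longleftrightarrow>
     (\<forall>d a b. admissible a \<longrightarrow> admissible b \<longrightarrow>
        dens (f d a b) = dens (f d b a) \<and>
        dens (f d a a) = dens a * vel a $ d \<and>
        mom (f d a b) = dens (f d a b) *\<^sub>R avg (vel a) (vel b)
                        + axis d (avg (pressure K \<gamma> a) (pressure K \<gamma> b)) \<and>
        rhotheta (f d a b) = gamma_mean \<gamma> (rhotheta a) (rhotheta b) * avg (vel a $ d) (vel b $ d))"

definition etec_form :: "real \<Rightarrow> real \<Rightarrow> flux \<Rightarrow> bool" where
  "etec_form K \<gamma> f \<longleftrightarrow>
     (\<forall>d a b. admissible a \<longrightarrow> admissible b \<longrightarrow>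
        dens (f d a b) = rhotheta (f d a b) * log_mean (1 / theta a) (1 / theta b) \<and>
        mom (f d a b) = dens (f d a b) *\<^sub>R avg (vel a) (vel b)
                        + axis d (avg (pressure K \<gamma> a) (pressure K \<gamma> b)) \<and>
        rhotheta (f d a b) = gamma_mean \<gamma> (rhotheta a) (rhotheta b) * avg (vel a $ d) (vel b $ d))"

definition density_flux_form :: "(state \<Rightarrow> state \<Rightarrow> real) \<Rightarrow> flux \<Rightarrow> bool" where
  "density_flux_form rbar f \<longleftrightarrow>
     (\<forall>d a b. admissible a \<longrightarrow> admissible b \<longrightarrow>
        dens (f d a b) = rbar a b * avg (vel a) (vel b) $ d)"

definition noncons_flux_form :: "(state \<Rightarrow> state \<Rightarrow> real) \<Rightarrow> noncons_flux \<Rightarrow> bool" where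
  "noncons_flux_form rbar g \<longleftrightarrow>
     (\<forall>d a b \<phi>a \<phi>b. admissible a \<longrightarrow> admissible b \<longrightarrow>
        g d (a, \<phi>a) (b, \<phi>b) = (0, axis d (rbar a b * (\<phi>b - \<phi>a)), 0))"

definition contract :: "(3 \<Rightarrow> 'a::real_vector) \<Rightarrow> real^3 \<Rightarrow> 'a" where
  "contract f a = (\<Sum>d\<in>UNIV. (a $ d) *\<^sub>R f d)"


section \<open>Lobatto-Gauss-Legendre collocation\<close>

text \<open>Legendre polynomials by Rodrigues' formula.\<close>

definition legendre :: "nat \<Rightarrow> real poly" where
  "legendre n = smult (1 / (2 ^ n * fact n)) ((pderiv ^^ n) ([:-1, 0, 1:] ^ n))"

definition lgl_nodes :: "nat \<Rightarrow> (nat \<Rightarrow> real) \<Rightarrow> bool" where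
  "lgl_nodes N \<xi> \<longleftrightarrow> strict_mono_on {..N} \<xi> \<and> \<xi> 0 = -1 \<and> \<xi> N = 1 \<and>
     (\<forall>i. 0 < i \<and> i < N \<longrightarrow> poly (pderiv (legendre N)) (\<xi> i) = 0)"

definition lagrange :: "nat \<Rightarrow> (nat \<Rightarrow> real) \<Rightarrow> nat \<Rightarrow> real poly" where
  "lagrange N \<xi> j = (\<Prod>m\<in>{..N} - {j}. smult (1 / (\<xi> j - \<xi> m)) [:- \<xi> m, 1:])"

definition quad_weight :: "nat \<Rightarrow> (nat \<Rightarrow> real) \<Rightarrow> nat \<Rightarrow> real" where
  "quad_weight N \<xi> i = integral {-1..1} (poly (lagrange N \<xi> i))"

definition deriv_matrix :: "nat \<Rightarrow> (nat \<Rightarrow> real) \<Rightarrow> nat \<Rightarrow> nat \<Rightarrow> real" where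
  "deriv_matrix N \<xi> i j = poly (pderiv (lagrange N \<xi> j)) (\<xi> i)"

definition Q_matrix :: "nat \<Rightarrow> (nat \<Rightarrow> real) \<Rightarrow> nat \<Rightarrow> nat \<Rightarrow> real" where
  "Q_matrix N \<xi> i j = quad_weight N \<xi> i * deriv_matrix N \<xi> i j"


section \<open>Elements\<close>

text \<open>Nodal data of a curvilinear element: mapping Jacobian, the contravariant metric vectors
  \<open>J a\<^sup>1\<close>, \<open>J a\<^sup>2\<close>, \<open>J a\<^sup>3\<close>, and the geopotential.  The first index of \<open>metric\<close> is the reference
  direction.\<close>

record element =
  jac :: "nat \<Rightarrow> nat \<Rightarrow> nat \<Rightarrow> real"
  metric :: "3 \<Rightarrow> nat \<Rightarrow> nat \<Rightarrow> nat \<Rightarrow> real^3"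
  geopot :: "nat \<Rightarrow> nat \<Rightarrow> nat \<Rightarrow> real"

datatype side = Lower | Upper

text \<open>What an element sees of the adjacent elements.  Each face is given by its side and its
  reference direction; the two remaining arguments are the remaining node indices, in increasing
  order of direction.  Metric vectors of neighbours are expressed in the orientation of the element
  itself.\<close>

record neighbours =
  nb_node :: "side \<Rightarrow> 3 \<Rightarrow> nat \<Rightarrow> nat \<Rightarrow> nodal"
  nb_metric :: "side \<Rightarrow> 3 \<Rightarrow> nat \<Rightarrow> nat \<Rightarrow> real^3"

text \<open>The discrete metric identities: constants are divergence-free on the element.  They are the
  usual requirement on curvilinear metric terms, satisfied by construction if these are computed in
  (discrete) curl form.\<close>

definition metric_identities :: "nat \<Rightarrow> (nat \<Rightarrow> real) \<Rightarrow> element \<Rightarrow> bool" where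
  "metric_identities N \<xi> el \<longleftrightarrow>
     (\<forall>i\<le>N. \<forall>j\<le>N. \<forall>k\<le>N.
        (\<Sum>m\<le>N. deriv_matrix N \<xi> i m *\<^sub>R metric el 1 m j k)
      + (\<Sum>m\<le>N. deriv_matrix N \<xi> j m *\<^sub>R metric el 2 i m k)
      + (\<Sum>m\<le>N. deriv_matrix N \<xi> k m *\<^sub>R metric el 3 i j m) = 0)"

text \<open>The metric vectors normal to a face agree from both sides (conforming, watertight mesh).\<close>

definition conforming :: "nat \<Rightarrow> element \<Rightarrow> neighbours \<Rightarrow> bool" where
  "conforming N el nb \<longleftrightarrow>
     (\<forall>a\<le>N. \<forall>b\<le>N.
        nb_metric nb Lower 1 a b = metric el 1 0 a b \<and> nb_metric nb Upper 1 a b = metric el 1 N a b \<and>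
        nb_metric nb Lower 2 a b = metric el 2 a 0 b \<and> nb_metric nb Upper 2 a b = metric el 2 a N b \<and>
        nb_metric nb Lower 3 a b = metric el 3 a b 0 \<and> nb_metric nb Upper 3 a b = metric el 3 a b N)"

definition element_geometry :: "nat \<Rightarrow> (nat \<Rightarrow> real) \<Rightarrow> element \<Rightarrow> neighbours \<Rightarrow> bool" where
  "element_geometry N \<xi> el nb \<longleftrightarrow>
     (\<forall>i\<le>N. \<forall>j\<le>N. \<forall>k\<le>N. jac el i j k > 0) \<and> metric_identities N \<xi> el \<and> conforming N el nb"


section \<open>The semi-discretization\<close>

text \<open>Volume and surface, conservative and non-conservative numerical fluxes.\<close>

record scheme =
  f_vol :: flux
  f_surf :: flux
  g_vol :: noncons_flux
  g_surf :: noncons_flux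

text \<open>Contribution of one reference direction at node \<open>i\<close> of a line of nodes with nodal values \<open>z\<close>
  and metric vectors \<open>A\<close>, before multiplication by the transversal weights; \<open>zL\<close>, \<open>aL\<close> and
  \<open>zR\<close>, \<open>aR\<close> belong to the adjacent nodes across the lower and the upper face.\<close>

definition line_residual ::
  "real \<Rightarrow> real \<Rightarrow> scheme \<Rightarrow> nat \<Rightarrow> (nat \<Rightarrow> real) \<Rightarrow> (nat \<Rightarrow> nodal) \<Rightarrow> (nat \<Rightarrow> real^3)
   \<Rightarrow> nodal \<Rightarrow> real^3 \<Rightarrow> nodal \<Rightarrow> real^3 \<Rightarrow> nat \<Rightarrow> state" where
  "line_residual K \<gamma> s N \<xi> z A zL aL zR aR i =
     - 2 *\<^sub>R (\<Sum>m\<le>N. Q_matrix N \<xi> i m *\<^sub>R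
                contract (\<lambda>d. f_vol s d (fst (z i)) (fst (z m))) (avg (A i) (A m)))
     - (\<Sum>m\<le>N. Q_matrix N \<xi> i m *\<^sub>R
                contract (\<lambda>d. g_vol s d (z i) (z m)) (avg (A i) (A m)))
     - (if i = 0 then contract (\<lambda>d. physical_flux K \<gamma> d (fst (z 0))) (A 0) else 0)
     + (if i = N then contract (\<lambda>d. physical_flux K \<gamma> d (fst (z N))) (A N) else 0)
     + (if i = 0 then contract (\<lambda>d. f_surf s d (fst (z 0)) (fst zL)) (avg (A 0) aL)
                      + (1/2) *\<^sub>R contract (\<lambda>d. g_surf s d (z 0) zL) (avg (A 0) aL) else 0)
     - (if i = N then contract (\<lambda>d. f_surf s d (fst (z N)) (fst zR)) (avg (A N) aR)
                      + (1/2) *\<^sub>R contract (\<lambda>d. g_surf s d (z N) zR) (avg (A N) aR) else 0)"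

definition residual ::
  "real \<Rightarrow> real \<Rightarrow> scheme \<Rightarrow> nat \<Rightarrow> (nat \<Rightarrow> real) \<Rightarrow> element \<Rightarrow> neighbours
   \<Rightarrow> (nat \<Rightarrow> nat \<Rightarrow> nat \<Rightarrow> state) \<Rightarrow> nat \<Rightarrow> nat \<Rightarrow> nat \<Rightarrow> state" where
  "residual K \<gamma> s N \<xi> el nb u i j k =
     (let w = quad_weight N \<xi>; z = (\<lambda>i j k. (u i j k, geopot el i j k)) in
        (w j * w k) *\<^sub>R line_residual K \<gamma> s N \<xi> (\<lambda>m. z m j k) (\<lambda>m. metric el 1 m j k)
           (nb_node nb Lower 1 j k) (nb_metric nb Lower 1 j k)
           (nb_node nb Upper 1 j k) (nb_metric nb Upper 1 j k) i
      + (w i * w k) *\<^sub>R line_residual K \<gamma> s N \<xi> (\<lambda>m. z i m k) (\<lambda>m. metric el 2 i m k)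
           (nb_node nb Lower 2 i k) (nb_metric nb Lower 2 i k)
           (nb_node nb Upper 2 i k) (nb_metric nb Upper 2 i k) j
      + (w i * w j) *\<^sub>R line_residual K \<gamma> s N \<xi> (\<lambda>m. z i j m) (\<lambda>m. metric el 3 i j m)
           (nb_node nb Lower 3 i j) (nb_metric nb Lower 3 i j)
           (nb_node nb Upper 3 i j) (nb_metric nb Upper 3 i j) k)"

definition nodal_mass :: "nat \<Rightarrow> (nat \<Rightarrow> real) \<Rightarrow> element \<Rightarrow> nat \<Rightarrow> nat \<Rightarrow> nat \<Rightarrow> real" where
  "nodal_mass N \<xi> el i j k =
     jac el i j k * (quad_weight N \<xi> i * quad_weight N \<xi> j * quad_weight N \<xi> k)"

text \<open>At time \<open>t\<close> the nodal values \<open>u\<close> of the element, as functions of time, satisfy the scheme.\<close>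

definition solves_at ::
  "real \<Rightarrow> real \<Rightarrow> scheme \<Rightarrow> nat \<Rightarrow> (nat \<Rightarrow> real) \<Rightarrow> element \<Rightarrow> neighbours
   \<Rightarrow> (real \<Rightarrow> nat \<Rightarrow> nat \<Rightarrow> nat \<Rightarrow> state) \<Rightarrow> real \<Rightarrow> bool" where
  "solves_at K \<gamma> s N \<xi> el nb u t \<longleftrightarrow>
     (\<forall>i\<le>N. \<forall>j\<le>N. \<forall>k\<le>N. \<exists>u'.
        ((\<lambda>\<tau>. u \<tau> i j k) has_vector_derivative u') (at t) \<and>
        nodal_mass N \<xi> el i j k *\<^sub>R u' = residual K \<gamma> s N \<xi> el nb (u t) i j k)"

definition admissible_data ::
  "nat \<Rightarrow> neighbours \<Rightarrow> (nat \<Rightarrow> nat \<Rightarrow> nat \<Rightarrow> state) \<Rightarrow> bool" where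
  "admissible_data N nb u \<longleftrightarrow>
     (\<forall>i\<le>N. \<forall>j\<le>N. \<forall>k\<le>N. admissible (u i j k)) \<and>
     (\<forall>sd l. \<forall>a\<le>N. \<forall>b\<le>N. admissible (fst (nb_node nb sd l a b)))"


section \<open>Total energy conservation\<close>

text \<open>Numerical fluxes of the total energy: single-valued at an interface (symmetric in the two
  nodes) and consistent with the physical total energy flux \<open>(U + p) v\<^sub>d\<close>.\<close>

definition numerical_energy_flux :: "real \<Rightarrow> real \<Rightarrow> (3 \<Rightarrow> nodal \<Rightarrow> nodal \<Rightarrow> real) \<Rightarrow> bool" where
  "numerical_energy_flux K \<gamma> F \<longleftrightarrow>
     (\<forall>d x y. admissible (fst x) \<longrightarrow> admissible (fst y) \<longrightarrow> F d x y = F d y x) \<and>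
     (\<forall>d u \<phi>. admissible u \<longrightarrow>
        F d (u, \<phi>) (u, \<phi>) = (total_energy K \<gamma> \<phi> u + pressure K \<gamma> u) * vel u $ d)"

definition interface_differences ::
  "(3 \<Rightarrow> nodal \<Rightarrow> nodal \<Rightarrow> real) \<Rightarrow> nat \<Rightarrow> (nat \<Rightarrow> real) \<Rightarrow> element \<Rightarrow> neighbours
   \<Rightarrow> (nat \<Rightarrow> nat \<Rightarrow> nat \<Rightarrow> state) \<Rightarrow> real" where
  "interface_differences F N \<xi> el nb u =
     (let w = quad_weight N \<xi>; z = (\<lambda>i j k. (u i j k, geopot el i j k));
          Fn = (\<lambda>x y A B. contract (\<lambda>d. F d x y) (avg A B)) in
      \<Sum>a\<le>N. \<Sum>b\<le>N. w a * w b *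
        (  Fn (z 0 a b) (nb_node nb Lower 1 a b) (metric el 1 0 a b) (nb_metric nb Lower 1 a b)
         - Fn (z N a b) (nb_node nb Upper 1 a b) (metric el 1 N a b) (nb_metric nb Upper 1 a b)
         + Fn (z a 0 b) (nb_node nb Lower 2 a b) (metric el 2 a 0 b) (nb_metric nb Lower 2 a b)
         - Fn (z a N b) (nb_node nb Upper 2 a b) (metric el 2 a N b) (nb_metric nb Upper 2 a b)
         + Fn (z a b 0) (nb_node nb Lower 3 a b) (metric el 3 a b 0) (nb_metric nb Lower 3 a b)
         - Fn (z a b N) (nb_node nb Upper 3 a b) (metric el 3 a b N) (nb_metric nb Upper 3 a b)))"

text \<open>The numerical energy flux is fixed before the polynomial degree, the element and the solution:
  it depends on the numerical fluxes of the scheme and on the two adjacent nodal values only.\<close>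

definition total_energy_conservative :: "real \<Rightarrow> real \<Rightarrow> scheme \<Rightarrow> bool" where
  "total_energy_conservative K \<gamma> s \<longleftrightarrow>
     (\<exists>F. numerical_energy_flux K \<gamma> F \<and>
       (\<forall>N \<xi> el nb u t.
          N \<ge> 1 \<longrightarrow> lgl_nodes N \<xi> \<longrightarrow> element_geometry N \<xi> el nb \<longrightarrow>
          admissible_data N nb (u t) \<longrightarrow> solves_at K \<gamma> s N \<xi> el nb u t \<longrightarrow>
          (\<Sum>i\<le>N. \<Sum>j\<le>N. \<Sum>k\<le>N.
             entropy_vars K \<gamma> (geopot el i j k) (u t i j k) \<bullet> residual K \<gamma> s N \<xi> el nb (u t) i j k)
            = interface_differences F N \<xi> el nb (u t) \<and>
          ((\<lambda>\<tau>. \<Sum>i\<le>N. \<Sum>j\<le>N. \<Sum>k\<le>N.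
               nodal_mass N \<xi> el i j k * total_energy K \<gamma> (geopot el i j k) (u \<tau> i j k))
             has_real_derivative interface_differences F N \<xi> el nb (u t)) (at t)))"

end

theory Submission
  imports Defs
begin

text \<open>Let \<open>w\<close> be the gradient of the total energy \<open>U\<close> with respect to the conserved variables, i.e.
  \<open>w = (\<phi> - |V|\<^sup>2/2, V, K \<gamma>/(\<gamma> - 1) (\<rho>\<theta>) powr (\<gamma> - 1))\<close>.  For two adjacent nodal values \<open>x\<close> and \<open>y\<close> put
  \<open>G\<^sub>d(x, y) = w\<^sub>x \<cdot> (f\<^sub>d(x, y) + g\<^sub>d(x, y)/2) - p\<^sub>x v\<^sub>x\<^sub>,\<^sub>d\<close>.  The heart of the matter is that \<open>G\<close> is
  symmetric in \<open>x\<close> and \<open>y\<close> (lemma \<open>energy_flux_symmetric\<close>).  Indeed, the kinetic part contracts to half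
  the density flux times \<open>V\<^sub>x \<cdot> V\<^sub>y\<close>.  The potential part is half the mean density times
  \<open>\<phi>\<^sub>x v\<^sub>y\<^sub>,\<^sub>d + \<phi>\<^sub>y v\<^sub>x\<^sub>,\<^sub>d\<close>, since density flux and non-conservative flux use the same mean density.
  The pressure part is symmetric because the mean \<open>{{\<rho>\<theta>}}\<^sub>\<gamma>\<close> times the jump of the last entropy
  variable is the jump of the pressure.  For equal arguments \<open>G\<^sub>d\<close> is \<open>(U + p) v\<^sub>d\<close>, so \<open>G\<close> is a
  numerical total energy flux.

  Conversely, \<open>w\<^sub>x \<cdot> (f\<^sub>d(x, y) + g\<^sub>d(x, y)/2) = G\<^sub>d(x, y) + p\<^sub>x v\<^sub>x\<^sub>,\<^sub>d\<close> splits every volume term into a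
  symmetric part and a part that depends on the first node only.  Summation by parts, i.e.
  \<open>Q + Q\<^sup>T = diag(-1, 0, \<dots>, 0, 1)\<close>, reduces the double sum of the symmetric part to the end points of a
  line of nodes.  There it cancels against the physical fluxes, and only the surface energy fluxes
  remain (\<open>line_energy_balance\<close>).  As the rows of \<open>Q\<close> sum to zero, the other part leaves \<open>p V\<close> contracted
  with the discrete derivatives of the metric vectors.  Added up over the three reference directions
  these contributions vanish by the metric identities (\<open>element_energy_balance\<close>).

  The summation-by-parts property follows from the exactness of Lobatto-Gauss-Legendre quadrature for
  polynomials of degree at most \<open>2 N - 1\<close>, which in turn rests on the orthogonality of the Legendre
  polynomials (\<open>lgl_quadrature_exact\<close>).\<close>


section \<open>Lobatto-Gauss-Legendre quadrature and summation by parts\<close>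

text \<open>The integral over the reference interval as a functional on polynomials, so that integration by
  parts becomes an algebraic identity.\<close>

definition poly_integral :: "real poly \<Rightarrow> real" where
  "poly_integral p = integral {-1..1} (poly p)"

lemma poly_integrable: "poly p integrable_on {a..b::real}"
  by (intro integrable_continuous_interval continuous_on_poly continuous_on_id)

lemma poly_integral_add: "poly_integral (p + q) = poly_integral p + poly_integral q"
  using integral_add[OF poly_integrable[of p] poly_integrable[of q]]
  by (simp add: poly_integral_def poly_add[abs_def])

lemma poly_integral_smult: "poly_integral (smult c p) = c * poly_integral p"
  by (simp add: poly_integral_def poly_smult[abs_def])

lemma poly_integral_0 [simp]: "poly_integral 0 = 0"
  by (simp add: poly_integral_def poly_0[abs_def])

lemma poly_integral_sum:
  "poly_integral (\<Sum>i\<in>I. p i) = (\<Sum>i\<in>I. poly_integral (p i))"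
  by (induction I rule: infinite_finite_induct) (simp_all add: poly_integral_add)

lemma poly_integral_pderiv: "poly_integral (pderiv p) = poly p 1 - poly p (-1)"
  unfolding poly_integral_def
  by (intro integral_unique fundamental_theorem_of_calculus)
     (auto intro!: has_field_derivative_at_within poly_DERIV
        simp: has_real_derivative_iff_has_vector_derivative[symmetric])

lemma poly_integral_by_parts:
  "poly_integral (pderiv p * q) =
     poly (p * q) 1 - poly (p * q) (-1) - poly_integral (p * pderiv q)"
  using poly_integral_pderiv[of "p * q"]
  by (simp add: pderiv_mult poly_integral_add mult.commute)

text \<open>The polynomial \<open>(x\<^sup>2 - 1)\<^sup>n\<close> whose \<open>n\<close>-th derivative is, up to a constant factor, the Legendre
  polynomial of degree \<open>n\<close>.\<close>

definition rodrigues :: "nat \<Rightarrow> real poly" where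
  "rodrigues n = [:-1, 0, 1:] ^ n"

lemma rodrigues_deriv_dvd:
  assumes "k \<le> n" shows "[:-1, 0, 1:] ^ (n - k) dvd (pderiv ^^ k) (rodrigues n)"
  using assms
proof (induction k)
  case 0 then show ?case by (simp add: rodrigues_def)
next
  case (Suc k)
  let ?b = "[:-1, 0, 1:] :: real poly"
  obtain m where m: "n - k = Suc m" "n - Suc k = m"
    using Suc.prems by (metis Suc_diff_Suc Suc_le_eq)
  obtain r where r: "(pderiv ^^ k) (rodrigues n) = ?b ^ Suc m * r"
    using Suc m by (auto elim: dvdE)
  have "pderiv (b ^ Suc m * r) = b ^ m * (b * pderiv r + smult (of_nat (Suc m)) (r * pderiv b))"
    for b :: "real poly"
    unfolding pderiv_mult pderiv_power_Suc unfolding power_Suc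
    by (simp add: algebra_simps del: of_nat_Suc)
  then have "(pderiv ^^ Suc k) (rodrigues n)
      = ?b ^ m * (?b * pderiv r + smult (of_nat (Suc m)) (r * pderiv ?b))"
    using r by (simp del: power_Suc mult_pCons_left mult_pCons_right)
  then show ?case using m(2) by (metis dvd_triv_left)
qed

lemma rodrigues_deriv_endpoint:
  assumes "k < n" "x = 1 \<or> x = -1"
  shows "poly ((pderiv ^^ k) (rodrigues n)) x = 0"
proof -
  have "[:-1, 0, 1:] dvd (pderiv ^^ k) (rodrigues n)"
    using rodrigues_deriv_dvd[of k n] assms(1) dvd_power[of "n - k" "[:-1, 0, 1:] :: real poly"]
    by (meson dvd_trans less_imp_le zero_less_diff)
  then obtain r where "(pderiv ^^ k) (rodrigues n) = [:-1, 0, 1:] * r" by (elim dvdE)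
  with assms(2) show ?thesis by auto
qed

text \<open>Integrating by parts \<open>k\<close> times moves all derivatives to \<open>q\<close>; the boundary terms vanish because
  \<open>\<plusminus>1\<close> are zeros of order \<open>n\<close> of \<open>(x\<^sup>2 - 1)\<^sup>n\<close>.\<close>

lemma rodrigues_deriv_orthogonal:
  assumes "k \<le> n" "degree q < k"
  shows "poly_integral ((pderiv ^^ k) (rodrigues n) * q) = 0"
  using assms
proof (induction k arbitrary: q)
  case (Suc k)
  let ?D = "(pderiv ^^ k) (rodrigues n)"
  have "poly_integral (?D * pderiv q) = 0"
  proof (cases "degree q = 0")
    case True
    then have "pderiv q = 0" by (simp add: pderiv_eq_0_iff)
    then show ?thesis by simp
  next
    case False
    then show ?thesis using Suc by (intro Suc.IH) (auto simp: degree_pderiv)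
  qed
  moreover have "poly ?D 1 = 0" "poly ?D (-1) = 0"
    using Suc.prems by (auto intro: rodrigues_deriv_endpoint)
  ultimately show ?case by (simp add: poly_integral_by_parts)
qed auto

lemma legendre_orthogonal:
  assumes "degree q < n" shows "poly_integral (legendre n * q) = 0"
  using rodrigues_deriv_orthogonal[of n n q] assms
  by (simp add: legendre_def rodrigues_def poly_integral_smult)

lemma degree_legendre: "degree (legendre n) = n"
proof -
  have "degree ((pderiv ^^ k) (rodrigues n)) = 2 * n - k" for k
    by (induction k) (auto simp: rodrigues_def degree_power_eq degree_pderiv)
  from this[of n] show ?thesis by (simp add: legendre_def rodrigues_def)
qed

lemma lgl_inj: "lgl_nodes N \<xi> \<Longrightarrow> inj_on \<xi> {..N}"
  by (simp add: lgl_nodes_def strict_mono_on_imp_inj_on)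

lemma poly_lagrange:
  assumes "inj_on \<xi> {..N}" "i \<le> N" "j \<le> N"
  shows "poly (lagrange N \<xi> j) (\<xi> i) = (if i = j then 1 else 0)"
proof (cases "i = j")
  case True
  have "\<xi> j - \<xi> m \<noteq> 0" if "m \<in> {..N} - {j}" for m
    using that assms by (auto dest: inj_onD)
  then show ?thesis using True
    by (auto simp: lagrange_def poly_prod diff_divide_distrib[symmetric] intro!: prod.neutral)
next
  case False
  then show ?thesis using assms by (auto simp: lagrange_def poly_prod intro!: prod_zero)
qed

lemma degree_lagrange:
  assumes "j \<le> N"
  shows "degree (lagrange N \<xi> j) \<le> N"
proof -
  have "degree (lagrange N \<xi> j) \<le> (\<Sum>m\<in>{..N} - {j}. degree (smult (1 / (\<xi> j - \<xi> m)) [:- \<xi> m, 1:]))"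
    unfolding lagrange_def by (rule degree_prod_sum_le[unfolded o_def]) simp
  also have "\<dots> \<le> (\<Sum>m\<in>{..N} - {j}. 1)" by (intro sum_mono) (auto split: if_splits)
  also have "\<dots> = N" using assms by simp
  finally show ?thesis .
qed

lemma lagrange_interpolation:
  assumes "inj_on \<xi> {..N}" "degree p \<le> N"
  shows "p = (\<Sum>j\<le>N. smult (poly p (\<xi> j)) (lagrange N \<xi> j))"
proof (rule ccontr)
  let ?q = "\<Sum>j\<le>N. smult (poly p (\<xi> j)) (lagrange N \<xi> j)"
  assume "p \<noteq> ?q"
  then have nz: "p - ?q \<noteq> 0" by simp
  have "\<xi> ` {..N} \<subseteq> {x. poly (p - ?q) x = 0}"
    using assms(1) by (auto simp: poly_sum poly_lagrange if_distrib cong: if_cong)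
  then have "card (\<xi> ` {..N}) \<le> degree (p - ?q)"
    using card_mono[OF poly_roots_finite[OF nz]] card_poly_roots_bound[OF nz] by (meson le_trans)
  moreover have "degree (p - ?q) \<le> N"
    using assms(2) degree_lagrange
    by (intro degree_diff_le degree_sum_le) (auto intro: order_trans[OF degree_smult_le])
  ultimately show False using assms(1) by (simp add: card_image)
qed

lemma sum_lagrange:
  assumes "inj_on \<xi> {..N}" shows "(\<Sum>j\<le>N. lagrange N \<xi> j) = 1"
  using lagrange_interpolation[OF assms, of 1] by simp

lemma quadrature_exact_interpolation:
  assumes "inj_on \<xi> {..N}" "degree p \<le> N"
  shows "(\<Sum>i\<le>N. quad_weight N \<xi> i * poly p (\<xi> i)) = poly_integral p"
  by (subst (2) lagrange_interpolation[OF assms])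
     (simp add: poly_integral_sum poly_integral_smult quad_weight_def
      poly_integral_def[symmetric] mult.commute)

text \<open>Interpolatory quadrature with \<open>N + 1\<close> nodes is exact up to degree \<open>N\<close> only.  The Lobatto nodes gain
  \<open>N - 1\<close> degrees, because they are the zeros of \<open>L = (x\<^sup>2 - 1) P\<^sub>N'\<close>, and \<open>L\<close> is orthogonal to every
  polynomial of degree at most \<open>N - 2\<close>.\<close>

lemma lgl_quadrature_exact:
  assumes "N \<ge> 1" "lgl_nodes N \<xi>" "degree p \<le> 2 * N - 1"
  shows "(\<Sum>i\<le>N. quad_weight N \<xi> i * poly p (\<xi> i)) = poly_integral p"
proof -
  define L where "L = [:-1, 0, 1:] * pderiv (legendre N)"
  have inj: "inj_on \<xi> {..N}" using assms(2) by (rule lgl_inj)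
  have nz: "pderiv (legendre N) \<noteq> 0"
    using assms(1) by (simp add: pderiv_eq_0_iff degree_legendre)
  have degL: "degree L = Suc N"
    using nz assms(1)
    unfolding L_def
    by (subst degree_mult_eq) (auto simp: degree_pderiv degree_legendre simp del: mult_pCons_left)
  have nodeL: "poly L (\<xi> i) = 0" if "i \<le> N" for i
    using assms(2) that unfolding L_def by (cases "i = 0"; cases "i = N") (auto simp: lgl_nodes_def)
  have "L \<noteq> 0" using degL by auto
  define q r where "q = p div L" and "r = p mod L"
  have p: "p = q * L + r" unfolding q_def r_def by (rule div_mult_mod_eq[symmetric])
  have degr: "degree r \<le> N"
    using degree_mod_less[of L p] \<open>L \<noteq> 0\<close> degL unfolding r_def
    by (metis One_nat_def degree_0 le0 less_Suc_eq_le nat.distinct(1))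
  have degq: "q = 0 \<or> degree q + 2 \<le> N"
  proof (cases "q = 0")
    case False
    then have "degree (q * L) = degree q + Suc N" using \<open>L \<noteq> 0\<close> degL by (simp add: degree_mult_eq)
    moreover have "degree (q * L) \<le> max (degree p) (degree r)"
      using degree_diff_le_max[of p r] p by (metis add_diff_cancel_right')
    ultimately show ?thesis using degr assms(1,3) by auto
  qed simp
  have "poly_integral (pderiv (legendre N) * ([:-1, 0, 1:] * q)) = 0"
  proof (cases "q = 0")
    case False
    have "degree (pderiv ([:-1, 0, 1:] * q)) < N"
      using False degq by (simp add: degree_pderiv degree_mult_eq del: mult_pCons_left)
    then show ?thesis by (simp add: poly_integral_by_parts legendre_orthogonal)
  qed simp
  then have "poly_integral p = poly_integral r"
    by (subst p, subst poly_integral_add)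
      (simp add: L_def mult.commute mult.left_commute del: mult_pCons_left mult_pCons_right)
  moreover have "poly p (\<xi> i) = poly r (\<xi> i)" if "i \<le> N" for i
    using nodeL[OF that] by (subst p) simp
  ultimately show ?thesis
    using quadrature_exact_interpolation[OF inj degr] by simp
qed

lemma pderiv_sum: "pderiv (\<Sum>i\<in>I. p i) = (\<Sum>i\<in>I. pderiv (p i))"
  by (induction I rule: infinite_finite_induct) (simp_all add: pderiv_add)

lemma Q_matrix_row_sum:
  assumes "inj_on \<xi> {..N}" shows "(\<Sum>j\<le>N. Q_matrix N \<xi> i j) = 0"
proof -
  have "(\<Sum>j\<le>N. pderiv (lagrange N \<xi> j)) = 0"
    using arg_cong[OF sum_lagrange[OF assms], of pderiv]
    by (simp add: pderiv_sum pderiv_1)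
  then have "(\<Sum>j\<le>N. deriv_matrix N \<xi> i j) = 0"
    by (simp add: deriv_matrix_def flip: poly_sum)
  then show ?thesis by (simp add: Q_matrix_def flip: sum_distrib_left)
qed

text \<open>The boundary terms arise as the integral of \<open>(l\<^sub>i l\<^sub>j)'\<close>, a polynomial of degree at most \<open>2 N - 1\<close>,
  which the quadrature evaluates exactly.\<close>

lemma summation_by_parts:
  assumes "N \<ge> 1" "lgl_nodes N \<xi>" "i \<le> N" "j \<le> N"
  shows "Q_matrix N \<xi> i j + Q_matrix N \<xi> j i =
    (if i = N \<and> j = N then 1 else 0) - (if i = 0 \<and> j = 0 then 1 else 0)"
proof -
  let ?l = "lagrange N \<xi>"
  have inj: "inj_on \<xi> {..N}" using assms(2) by (rule lgl_inj)
  have ends: "\<xi> 0 = -1" "\<xi> N = 1" using assms(2) by (auto simp: lgl_nodes_def)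
  have deg: "degree (pderiv (?l i * ?l j)) \<le> 2 * N - 1"
    using degree_mult_le[of "?l i" "?l j"] degree_lagrange[OF assms(3), of \<xi>]
      degree_lagrange[OF assms(4), of \<xi>] by (simp add: degree_pderiv)
  have "(\<Sum>m\<le>N. quad_weight N \<xi> m * poly (pderiv (?l i * ?l j)) (\<xi> m))
      = (\<Sum>m\<le>N. (if m = i then Q_matrix N \<xi> m j else 0) + (if m = j then Q_matrix N \<xi> m i else 0))"
    using assms(3,4)
    by (intro sum.cong refl) (auto simp: pderiv_mult poly_lagrange[OF inj] Q_matrix_def
        deriv_matrix_def distrib_left)
  then have "Q_matrix N \<xi> i j + Q_matrix N \<xi> j i
      = (\<Sum>m\<le>N. quad_weight N \<xi> m * poly (pderiv (?l i * ?l j)) (\<xi> m))"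
    using assms(3,4) by (simp add: sum.distrib)
  also have "\<dots> = poly (?l i * ?l j) (\<xi> N) - poly (?l i * ?l j) (\<xi> 0)"
    using lgl_quadrature_exact[OF assms(1,2) deg] by (simp add: poly_integral_pderiv ends)
  also have "\<dots> = (if i = N \<and> j = N then 1 else 0) - (if i = 0 \<and> j = 0 then 1 else 0)"
    using assms by (auto simp: poly_lagrange[OF inj])
  finally show ?thesis .
qed


section \<open>Two-point total energy flux\<close>

text \<open>The entropy variables in closed form: the gradient of the total energy with respect to density,
  momentum and density times potential temperature.\<close>

definition energy_gradient :: "real \<Rightarrow> real \<Rightarrow> real \<Rightarrow> state \<Rightarrow> state" where
  "energy_gradient K \<gamma> \<phi> u =
     (\<phi> - (norm (vel u))\<^sup>2 / 2, vel u, K * \<gamma> / (\<gamma> - 1) * rhotheta u powr (\<gamma> - 1))"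

lemma admissible_iff: "admissible u \<longleftrightarrow> dens u > 0 \<and> rhotheta u > 0"
  by (auto simp: admissible_def theta_def zero_less_divide_iff)

lemma inner_state: "v \<bullet> w = dens v * dens w + mom v \<bullet> mom w + rhotheta v * rhotheta w"
  by (simp add: dens_def mom_def rhotheta_def inner_prod_def)

lemma state_simps [simp]:
  "dens (u + w) = dens u + dens w" "mom (u + w) = mom u + mom w"
  "rhotheta (u + w) = rhotheta u + rhotheta w"
  "dens (c *\<^sub>R u) = c * dens u" "mom (c *\<^sub>R u) = c *\<^sub>R mom u"
  "rhotheta (c *\<^sub>R u) = c * rhotheta u"
  "dens (r, m, q) = r" "mom (r, m, q) = m" "rhotheta (r, m, q) = q"
  by (simp_all add: dens_def mom_def rhotheta_def)

lemma gderiv_total_energy: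
  assumes "admissible u"
  shows "GDERIV (total_energy K \<gamma> \<phi>) u :> energy_gradient K \<gamma> \<phi> u"
proof -
  have pos: "dens u > 0" "rhotheta u > 0" using assms by (auto simp: admissible_iff)
  define r where "r = inverse (dens u)"
  have bl: "(dens has_derivative dens) (at u)" "(mom has_derivative mom) (at u)"
      "(rhotheta has_derivative rhotheta) (at u)"
    unfolding dens_def[abs_def] mom_def[abs_def] rhotheta_def[abs_def]
    by (auto intro!: derivative_eq_intros)
  have kin: "(norm (vel w))\<^sup>2 = (mom w \<bullet> mom w) * (inverse (dens w))\<^sup>2" for w
    unfolding power2_norm_eq_inner by (simp add: vel_def power2_eq_square)
  have dP: "((\<lambda>w. rhotheta w powr \<gamma>) has_derivative
      (\<lambda>h. rhotheta h * (\<gamma> * rhotheta u powr (\<gamma> - 1)))) (at u)"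
    by (rule DERIV_compose_FDERIV[OF has_real_derivative_powr bl(3)]) (rule pos)
  have dM: "((\<lambda>w. mom w \<bullet> mom w) has_derivative (\<lambda>h. 2 * (mom u \<bullet> mom h))) (at u)"
    using has_derivative_inner[OF bl(2) bl(2)] by (simp add: inner_commute)
  have dI: "((\<lambda>w. (inverse (dens w))\<^sup>2) has_derivative (\<lambda>h. - 2 * r ^ 3 * dens h)) (at u)"
    using has_derivative_power[OF Deriv.has_derivative_inverse[OF _ bl(1)], of 2] pos(1)
    by (simp add: r_def power2_eq_square power3_eq_cube mult_ac)
  have "dens u * r = 1" using pos(1) by (simp add: r_def)
  have kinetic: "dens u * ((mom u \<bullet> mom u) * (- 2 * r ^ 3 * dh) + 2 * m * r\<^sup>2)
      = - 2 * (mom u \<bullet> mom u) * r\<^sup>2 * dh + 2 * m * r" for dh m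
  proof -
    have "dens u * ((mom u \<bullet> mom u) * (- 2 * r ^ 3 * dh) + 2 * m * r\<^sup>2)
        = (dens u * r) * (- 2 * (mom u \<bullet> mom u) * r\<^sup>2 * dh + 2 * m * r)"
      by (simp add: power2_eq_square power3_eq_cube algebra_simps)
    then show ?thesis using \<open>dens u * r = 1\<close> by simp
  qed
  have "(total_energy K \<gamma> \<phi> has_derivative (\<lambda>h.
      K / (\<gamma> - 1) * (rhotheta h * (\<gamma> * rhotheta u powr (\<gamma> - 1)))
      + (dens u * ((mom u \<bullet> mom u) * (- 2 * r ^ 3 * dens h) + 2 * (mom u \<bullet> mom h) * r\<^sup>2)
         + dens h * ((mom u \<bullet> mom u) * r\<^sup>2)) / 2 + dens h * \<phi>)) (at u)"
    using has_derivative_add[OF has_derivative_add[OF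
        has_derivative_mult_right[OF dP, of "K / (\<gamma> - 1)"]
        has_derivative_mult_right[OF has_derivative_mult[OF bl(1) has_derivative_mult[OF dM dI]], of "1/2"]]
        has_derivative_mult_left[OF bl(1), of \<phi>]]
    by (simp add: total_energy_def[abs_def] pressure_def kin r_def)
  moreover have "mom h \<bullet> vel u = r * (mom u \<bullet> mom h)" for h
    by (simp add: vel_def r_def inner_commute)
  ultimately show ?thesis
    unfolding gderiv_def kinetic
    by (simp add: energy_gradient_def inner_state kin r_def[symmetric] algebra_simps
        diff_divide_distrib)
qed

lemma entropy_vars_eq:
  assumes "admissible u"
  shows "entropy_vars K \<gamma> \<phi> u = energy_gradient K \<gamma> \<phi> u"
  unfolding entropy_vars_def
proof (rule the_equality)
  show "GDERIV (total_energy K \<gamma> \<phi>) u :> energy_gradient K \<gamma> \<phi> u"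
    using assms by (rule gderiv_total_energy)
next
  fix w assume "GDERIV (total_energy K \<gamma> \<phi>) u :> w"
  then have "(\<lambda>h. h \<bullet> w) = (\<lambda>h. h \<bullet> energy_gradient K \<gamma> \<phi> u)"
    using gderiv_total_energy[OF assms] unfolding gderiv_def by (rule has_derivative_unique)
  then show "w = energy_gradient K \<gamma> \<phi> u"
    by (metis vector_eq_ldot)
qed

lemma gamma_mean_commute: "gamma_mean \<gamma> a b = gamma_mean \<gamma> b a"
  using minus_divide_divide[of "b powr \<gamma> - a powr \<gamma>" "b powr (\<gamma> - 1) - a powr (\<gamma> - 1)"]
  by (auto simp: gamma_mean_def)

text \<open>The property that determines the mean \<open>{{\<cdot>}}\<^sub>\<gamma>\<close>: up to the factor \<open>K\<close>, it turns the jump of the last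
  entropy variable into the jump of the pressure.\<close>

lemma gamma_mean_jump:
  assumes "a > 0" "b > 0" "\<gamma> > 1"
  shows "\<gamma> / (\<gamma> - 1) * (b powr (\<gamma> - 1) - a powr (\<gamma> - 1)) * gamma_mean \<gamma> a b = b powr \<gamma> - a powr \<gamma>"
proof (cases "a = b")
  case False
  then have "a powr (\<gamma> - 1) \<noteq> b powr (\<gamma> - 1)"
    using assms powr_less_mono2[of "\<gamma> - 1" a b] powr_less_mono2[of "\<gamma> - 1" b a]
    by (auto simp: neq_iff)
  then show ?thesis using False assms by (simp add: gamma_mean_def)
qed simp

text \<open>The numerical total energy flux of a pair of two-point fluxes: the contraction of the entropy
  variables at the first node with the sum of the conservative flux and half of the non-conservative one, minus
  the flux potential \<open>p v\<^sub>d\<close> at the first node.\<close>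

definition energy_flux :: "real \<Rightarrow> real \<Rightarrow> flux \<Rightarrow> noncons_flux \<Rightarrow> 3 \<Rightarrow> nodal \<Rightarrow> nodal \<Rightarrow> real" where
  "energy_flux K \<gamma> f g d x y =
     energy_gradient K \<gamma> (snd x) (fst x) \<bullet> (f d (fst x) (fst y) + (1/2) *\<^sub>R g d x y)
       - pressure K \<gamma> (fst x) * vel (fst x) $ d"

text \<open>Both forms of the fluxes share the momentum and potential-temperature components, and the
  density component is prescribed separately; nothing else enters the energy balance.\<close>

lemma flux_form_components:
  assumes "density_flux_form rbar f" "tec_form K \<gamma> f \<or> etec_form K \<gamma> f"
    and "admissible a" "admissible b"
  shows "dens (f d a b) = rbar a b * avg (vel a) (vel b) $ d"
    and "mom (f d a b) = dens (f d a b) *\<^sub>R avg (vel a) (vel b)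
           + axis d (avg (pressure K \<gamma> a) (pressure K \<gamma> b))"
    and "rhotheta (f d a b) = gamma_mean \<gamma> (rhotheta a) (rhotheta b) * avg (vel a $ d) (vel b $ d)"
  using assms unfolding density_flux_form_def tec_form_def etec_form_def by blast+

text \<open>This form of the energy flux is symmetric in the two nodes.\<close>

lemma energy_flux_eq:
  assumes "\<gamma> > 1"
    and "density_flux_form rbar f" "tec_form K \<gamma> f \<or> etec_form K \<gamma> f" "noncons_flux_form rbar g"
    and "admissible a" "admissible b"
  shows "energy_flux K \<gamma> f g d (a, \<phi>a) (b, \<phi>b) =
     rbar a b * (vel a \<bullet> vel b) * (vel a $ d + vel b $ d) / 4
     + rbar a b * (\<phi>a * vel b $ d + \<phi>b * vel a $ d) / 2
     + (pressure K \<gamma> a * vel b $ d + pressure K \<gamma> b * vel a $ d) / 2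
     + K * \<gamma> / (\<gamma> - 1) * (rhotheta a powr (\<gamma> - 1) + rhotheta b powr (\<gamma> - 1)) / 2
       * gamma_mean \<gamma> (rhotheta a) (rhotheta b) * (vel a $ d + vel b $ d) / 2
     - (pressure K \<gamma> a + pressure K \<gamma> b) * (vel a $ d + vel b $ d) / 4" (is "_ = ?r")
proof -
  define va vb where "va = vel a $ d" and "vb = vel b $ d"
  define q where "q = gamma_mean \<gamma> (rhotheta a) (rhotheta b)"
  define ha hb where "ha = K * \<gamma> / (\<gamma> - 1) * rhotheta a powr (\<gamma> - 1)"
    and "hb = K * \<gamma> / (\<gamma> - 1) * rhotheta b powr (\<gamma> - 1)"
  have pos: "rhotheta a > 0" "rhotheta b > 0" using assms(5,6) by (auto simp: admissible_iff)
  have hq: "(hb - ha) * q = pressure K \<gamma> b - pressure K \<gamma> a"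
    using arg_cong[OF gamma_mean_jump[OF pos assms(1)], of "\<lambda>x. K * x"]
    by (simp add: hb_def ha_def q_def pressure_def algebra_simps)
  have g: "g d (a, \<phi>a) (b, \<phi>b) = (0, axis d (rbar a b * (\<phi>b - \<phi>a)), 0)"
    using assms(4-6) unfolding noncons_flux_form_def by blast
  \<comment> \<open>The definition of the flux, evaluated.  It agrees with the symmetric expression up to a
    multiple of the difference of the two sides of \<open>hq\<close>.\<close>
  have "energy_flux K \<gamma> f g d (a, \<phi>a) (b, \<phi>b) =
     (\<phi>a - vel a \<bullet> vel a / 2) * (rbar a b * (va + vb) / 2)
     + rbar a b * (va + vb) / 2 * (vel a \<bullet> vel a + vel a \<bullet> vel b) / 2
     + va * (pressure K \<gamma> a + pressure K \<gamma> b) / 2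
     + va * (rbar a b * (\<phi>b - \<phi>a)) / 2 + ha * q * (va + vb) / 2 - pressure K \<gamma> a * va"
    using g
    by (simp add: flux_form_components[OF assms(2,3,5,6)] energy_flux_def inner_state
        energy_gradient_def avg_def inner_axis
        inner_add_right inner_scaleR_right power2_norm_eq_inner va_def vb_def ha_def q_def
        algebra_simps add_divide_distrib diff_divide_distrib)
  also have "\<dots> = ?r + (pressure K \<gamma> b - pressure K \<gamma> a - (hb - ha) * q) * (va + vb) / 4"
    unfolding va_def[symmetric] vb_def[symmetric] q_def[symmetric] distrib_left
      ha_def[symmetric] hb_def[symmetric]
    by (simp add: field_simps)
  finally show ?thesis using hq by simp
qed

lemma energy_flux_symmetric:
  assumes "\<gamma> > 1" "density_mean rbar"
    and "density_flux_form rbar f" "tec_form K \<gamma> f \<or> etec_form K \<gamma> f" "noncons_flux_form rbar g"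
    and "admissible (fst x)" "admissible (fst y)"
  shows "energy_flux K \<gamma> f g d x y = energy_flux K \<gamma> f g d y x"
proof -
  obtain a \<phi>a b \<phi>b where xy: "x = (a, \<phi>a)" "y = (b, \<phi>b)" by (metis surj_pair)
  have "rbar a b = rbar b a" using assms(2,6,7) xy unfolding density_mean_def by (metis fst_conv)
  then show ?thesis
    using assms(6,7) unfolding xy
    by (simp add: energy_flux_eq[OF assms(1,3,4,5)] gamma_mean_commute[of \<gamma> "rhotheta b"]
        inner_commute[of "vel b"] add.commute)
qed

text \<open>The physical fluxes at the boundary nodes of an element satisfy the same contraction identity as the
  two-point fluxes, which is the second equation.\<close>

lemma energy_flux_consistent:
  assumes "\<gamma> > 1" "density_mean rbar"
    and "density_flux_form rbar f" "tec_form K \<gamma> f \<or> etec_form K \<gamma> f" "noncons_flux_form rbar g"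
    and "admissible a"
  shows "energy_flux K \<gamma> f g d (a, \<phi>) (a, \<phi>)
           = (total_energy K \<gamma> \<phi> a + pressure K \<gamma> a) * vel a $ d"
    and "energy_flux K \<gamma> f g d (a, \<phi>) (a, \<phi>)
           = energy_gradient K \<gamma> \<phi> a \<bullet> physical_flux K \<gamma> d a - pressure K \<gamma> a * vel a $ d"
proof -
  have pos: "dens a > 0" "rhotheta a > 0" using assms(6) by (auto simp: admissible_iff)
  have r: "rbar a a = dens a" using assms(2,6) unfolding density_mean_def by blast
  have powr: "rhotheta a powr \<gamma> = rhotheta a powr (\<gamma> - 1) * rhotheta a"
    using pos(2) powr_add[of "rhotheta a" "\<gamma> - 1" 1] by simp
  show 1: "energy_flux K \<gamma> f g d (a, \<phi>) (a, \<phi>)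
           = (total_energy K \<gamma> \<phi> a + pressure K \<gamma> a) * vel a $ d"
    using assms(1) by (simp add: energy_flux_eq[OF assms(1,3,4,5,6,6)] r gamma_mean_def
        total_energy_def pressure_def powr power2_norm_eq_inner field_simps)
  show "energy_flux K \<gamma> f g d (a, \<phi>) (a, \<phi>)
           = energy_gradient K \<gamma> \<phi> a \<bullet> physical_flux K \<gamma> d a - pressure K \<gamma> a * vel a $ d"
    using assms(1) unfolding 1
    by (simp add: energy_gradient_def physical_flux_def inner_state inner_axis inner_add_right
        total_energy_def pressure_def powr power2_norm_eq_inner field_simps)
qed


section \<open>Energy balance on an element\<close>

lemma inner_contract: "w \<bullet> contract f a = contract (\<lambda>d. w \<bullet> f d) a"
  by (simp add: contract_def inner_sum_right)

lemma contract_vector: "contract (\<lambda>d. c * v $ d) a = c * (v \<bullet> a)"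
  by (simp add: contract_def inner_vec_def sum_distrib_left mult_ac)

lemma contract_add: "contract (\<lambda>d. f d + g d) a = contract f a + contract g a"
  by (simp add: contract_def scaleR_add_right sum.distrib)

lemma avg_self [simp]: "avg a a = a"
  by (simp add: avg_def scaleR_2[symmetric])

lemma avg_commute: "avg a b = avg b a"
  by (simp add: avg_def add.commute)

text \<open>This splitting holds for arbitrary two-point fluxes, so at an interface nothing is required of the
  state on the other side.\<close>

lemma contract_numerical_flux:
  "energy_gradient K \<gamma> (snd x) (fst x) \<bullet> contract (\<lambda>d. f d (fst x) (fst y)) a
     + (energy_gradient K \<gamma> (snd x) (fst x) \<bullet> contract (\<lambda>d. g d x y) a) / 2
   = contract (\<lambda>d. energy_flux K \<gamma> f g d x y) a + pressure K \<gamma> (fst x) * (vel (fst x) \<bullet> a)"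
  unfolding inner_contract contract_vector[symmetric] contract_add[symmetric]
  by (simp add: contract_def energy_flux_def inner_add_right sum_divide_distrib
      sum.distrib algebra_simps)

text \<open>The flux differencing form: summation by parts collapses the double sum of any symmetric two-point
  quantity to its values at the two end points.\<close>

lemma sum_sbp_symmetric:
  assumes "N \<ge> 1" "lgl_nodes N \<xi>"
    and sym: "\<And>i m. i \<le> N \<Longrightarrow> m \<le> N \<Longrightarrow> S i m = S m i"
  shows "2 * (\<Sum>i\<le>N. \<Sum>m\<le>N. Q_matrix N \<xi> i m * S i m) = S N N - S 0 0"
proof -
  have "2 * (\<Sum>i\<le>N. \<Sum>m\<le>N. Q_matrix N \<xi> i m * S i m)
      = (\<Sum>i\<le>N. \<Sum>m\<le>N. Q_matrix N \<xi> i m * S i m) + (\<Sum>i\<le>N. \<Sum>m\<le>N. Q_matrix N \<xi> m i * S m i)"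
    using sum.swap[of "\<lambda>i m. Q_matrix N \<xi> i m * S i m" "{..N}" "{..N}"] by simp
  also have "\<dots> = (\<Sum>i\<le>N. \<Sum>m\<le>N. (Q_matrix N \<xi> i m + Q_matrix N \<xi> m i) * S i m)"
    unfolding sum.distrib[symmetric]
    by (intro sum.cong refl) (simp add: distrib_right sym)
  also have "\<dots> = (\<Sum>i\<le>N. \<Sum>m\<le>N. (if i = N then if m = N then S N N else 0 else 0)
      - (if i = 0 then if m = 0 then S 0 0 else 0 else 0))"
    by (intro sum.cong refl) (auto simp: summation_by_parts[OF assms(1,2)])
  also have "\<dots> = S N N - S 0 0"
    by (simp add: sum_subtractf if_distrib[of "\<lambda>f. sum f _"] sum.If_cases)
  finally show ?thesis .
qed

text \<open>Energy balance along one line of nodes.  Besides the interface fluxes there remains the flux potential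
  \<open>p V\<close> contracted with the derivative of the metric vectors along the line; it cancels only after
  summation over the three reference directions.\<close>

lemma line_energy_balance:
  fixes K \<gamma> :: real and z :: "nat \<Rightarrow> nodal"
  defines "E \<equiv> \<lambda>i. energy_gradient K \<gamma> (snd (z i)) (fst (z i))"
  assumes "\<gamma> > 1" "density_mean rbar" "density_flux_form rbar (f_vol s)"
    and "tec_form K \<gamma> (f_vol s) \<or> etec_form K \<gamma> (f_vol s)" "noncons_flux_form rbar (g_vol s)"
    and "N \<ge> 1" "lgl_nodes N \<xi>" "\<And>i. i \<le> N \<Longrightarrow> admissible (fst (z i))"
    and "aL = A 0" "aR = A N"
  shows "(\<Sum>i\<le>N. E i \<bullet> line_residual K \<gamma> s N \<xi> z A zL aL zR aR i) =
     contract (\<lambda>d. energy_flux K \<gamma> (f_surf s) (g_surf s) d (z 0) zL) (avg (A 0) aL)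
     - contract (\<lambda>d. energy_flux K \<gamma> (f_surf s) (g_surf s) d (z N) zR) (avg (A N) aR)
     - (\<Sum>i\<le>N. quad_weight N \<xi> i * (pressure K \<gamma> (fst (z i)) *
          (vel (fst (z i)) \<bullet> (\<Sum>m\<le>N. deriv_matrix N \<xi> i m *\<^sub>R A m))))"
proof -
  note vol = assms(2-6)
  define S where "S i m = contract (\<lambda>d. energy_flux K \<gamma> (f_vol s) (g_vol s) d (z i) (z m))
    (avg (A i) (A m))" for i m
  define \<psi> where "\<psi> i a = pressure K \<gamma> (fst (z i)) * (vel (fst (z i)) \<bullet> a)" for i a
  define GL where "GL = contract (\<lambda>d. energy_flux K \<gamma> (f_surf s) (g_surf s) d (z 0) zL) (avg (A 0) aL)"
  define GR where "GR = contract (\<lambda>d. energy_flux K \<gamma> (f_surf s) (g_surf s) d (z N) zR) (avg (A N) aR)"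
  have Ssym: "S i m = S m i" if "i \<le> N" "m \<le> N" for i m
    using that assms(9) unfolding S_def
    by (simp add: energy_flux_symmetric[OF vol, of "z i" "z m"] avg_commute[of "A i"])
  have phys: "E i \<bullet> contract (\<lambda>d. physical_flux K \<gamma> d (fst (z i))) (A i) = S i i + \<psi> i (A i)"
    if "i \<le> N" for i
  proof -
    have "S i i = contract (\<lambda>d. E i \<bullet> physical_flux K \<gamma> d (fst (z i))
        - pressure K \<gamma> (fst (z i)) * vel (fst (z i)) $ d) (A i)"
      using energy_flux_consistent(2)[OF vol assms(9)[OF that], of _ "snd (z i)"]
      by (simp add: S_def E_def)
    then show ?thesis
      unfolding \<psi>_def inner_contract contract_vector[symmetric] by (simp flip: contract_add)
  qed
  define fv gv where
    "fv i m = E i \<bullet> contract (\<lambda>d. f_vol s d (fst (z i)) (fst (z m))) (avg (A i) (A m))" and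
    "gv i m = E i \<bullet> contract (\<lambda>d. g_vol s d (z i) (z m)) (avg (A i) (A m))" for i m
  have volume: "2 * fv i m + gv i m = 2 * S i m + \<psi> i (A i) + \<psi> i (A m)" for i m
  proof -
    have "fv i m + gv i m / 2 = S i m + \<psi> i (avg (A i) (A m))"
      unfolding fv_def gv_def S_def \<psi>_def E_def by (rule contract_numerical_flux)
    moreover have "2 * \<psi> i (avg (A i) (A m)) = \<psi> i (A i) + \<psi> i (A m)"
      by (simp add: \<psi>_def avg_def inner_add_right distrib_left)
    ultimately show ?thesis by simp
  qed
  have surf: "E 0 \<bullet> contract (\<lambda>d. f_surf s d (fst (z 0)) (fst zL)) (avg (A 0) aL)
       + (E 0 \<bullet> contract (\<lambda>d. g_surf s d (z 0) zL) (avg (A 0) aL)) / 2 = GL + \<psi> 0 (A 0)"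
    "E N \<bullet> contract (\<lambda>d. f_surf s d (fst (z N)) (fst zR)) (avg (A N) aR)
       + (E N \<bullet> contract (\<lambda>d. g_surf s d (z N) zR) (avg (A N) aR)) / 2 = GR + \<psi> N (A N)"
    unfolding GL_def GR_def E_def contract_numerical_flux by (simp_all add: \<psi>_def assms(10,11))
  \<comment> \<open>At an end node the potentials \<open>\<psi>\<close> of the physical and of the surface flux cancel, since the metric
    vectors agree from both sides of the face.\<close>
  have node: "E i \<bullet> line_residual K \<gamma> s N \<xi> z A zL aL zR aR i
      = - 2 * (\<Sum>m\<le>N. Q_matrix N \<xi> i m * S i m) - (\<Sum>m\<le>N. Q_matrix N \<xi> i m * \<psi> i (A m))
        + (if i = 0 then GL - S 0 0 else 0) + (if i = N then S N N - GR else 0)"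
    if "i \<le> N" for i
  proof -
    have "- 2 * (\<Sum>m\<le>N. Q_matrix N \<xi> i m * fv i m) - (\<Sum>m\<le>N. Q_matrix N \<xi> i m * gv i m)
      = - (\<Sum>m\<le>N. Q_matrix N \<xi> i m * (2 * fv i m + gv i m))"
      by (simp add: sum.distrib distrib_left sum_distrib_left mult.left_commute sum_negf)
    also have "\<dots> = - 2 * (\<Sum>m\<le>N. Q_matrix N \<xi> i m * S i m) - (\<Sum>m\<le>N. Q_matrix N \<xi> i m * \<psi> i (A m))
        - (\<Sum>m\<le>N. Q_matrix N \<xi> i m) * \<psi> i (A i)"
      unfolding volume
      by (simp add: sum.distrib distrib_left sum_distrib_left sum_distrib_right mult.left_commute
          sum_negf)
    finally have 1: "- 2 * (\<Sum>m\<le>N. Q_matrix N \<xi> i m * fv i m) - (\<Sum>m\<le>N. Q_matrix N \<xi> i m * gv i m)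
      = - 2 * (\<Sum>m\<le>N. Q_matrix N \<xi> i m * S i m) - (\<Sum>m\<le>N. Q_matrix N \<xi> i m * \<psi> i (A m))"
      by (simp add: Q_matrix_row_sum[OF lgl_inj[OF assms(8)]])
    have 2: "E i \<bullet> line_residual K \<gamma> s N \<xi> z A zL aL zR aR i
      = - 2 * (\<Sum>m\<le>N. Q_matrix N \<xi> i m * fv i m) - (\<Sum>m\<le>N. Q_matrix N \<xi> i m * gv i m)
        - (if i = 0 then E 0 \<bullet> contract (\<lambda>d. physical_flux K \<gamma> d (fst (z 0))) (A 0) else 0)
        + (if i = N then E N \<bullet> contract (\<lambda>d. physical_flux K \<gamma> d (fst (z N))) (A N) else 0)
        + (if i = 0 then E 0 \<bullet> contract (\<lambda>d. f_surf s d (fst (z 0)) (fst zL)) (avg (A 0) aL)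
             + (E 0 \<bullet> contract (\<lambda>d. g_surf s d (z 0) zL) (avg (A 0) aL)) / 2 else 0)
        - (if i = N then E N \<bullet> contract (\<lambda>d. f_surf s d (fst (z N)) (fst zR)) (avg (A N) aR)
             + (E N \<bullet> contract (\<lambda>d. g_surf s d (z N) zR) (avg (A N) aR)) / 2 else 0)"
      unfolding line_residual_def fv_def gv_def
        inner_add_right inner_diff_right inner_scaleR_right inner_sum_right
      by (simp add: inner_add_right)
    show ?thesis unfolding 2 1 surf phys[OF le0] phys[OF order_refl] by simp
  qed
  have "(\<Sum>i\<le>N. E i \<bullet> line_residual K \<gamma> s N \<xi> z A zL aL zR aR i)
      = - (2 * (\<Sum>i\<le>N. \<Sum>m\<le>N. Q_matrix N \<xi> i m * S i m))
        - (\<Sum>i\<le>N. \<Sum>m\<le>N. Q_matrix N \<xi> i m * \<psi> i (A m)) + (GL - S 0 0) + (S N N - GR)"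
    by (simp add: node sum.distrib sum_subtractf sum_distrib_left sum_negf)
  also have "\<dots> = GL - GR - (\<Sum>i\<le>N. \<Sum>m\<le>N. Q_matrix N \<xi> i m * \<psi> i (A m))"
    using sum_sbp_symmetric[of N \<xi> S, OF assms(7,8) Ssym] by simp
  also have "(\<Sum>i\<le>N. \<Sum>m\<le>N. Q_matrix N \<xi> i m * \<psi> i (A m))
     = (\<Sum>i\<le>N. quad_weight N \<xi> i * (pressure K \<gamma> (fst (z i)) *
          (vel (fst (z i)) \<bullet> (\<Sum>m\<le>N. deriv_matrix N \<xi> i m *\<^sub>R A m))))"
    by (simp add: \<psi>_def Q_matrix_def inner_sum_right sum_distrib_left mult_ac)
  finally show ?thesis unfolding GL_def GR_def .
qed

lemma sum_rotate:
  "(\<Sum>i\<in>A. \<Sum>j\<in>B. \<Sum>k\<in>C. f i j k) = (\<Sum>j\<in>B. \<Sum>k\<in>C. \<Sum>i\<in>A. f i j k)"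
  by (subst sum.swap) (intro sum.cong refl sum.swap)

lemma sum_swap_inner:
  "(\<Sum>i\<in>A. \<Sum>j\<in>B. \<Sum>k\<in>C. f i j k) = (\<Sum>i\<in>A. \<Sum>k\<in>C. \<Sum>j\<in>B. f i j k)"
  by (intro sum.cong refl sum.swap)

text \<open>The contributions of the three reference directions, each multiplied by its transversal weights, sum up
  to the interface differences; the metric identities remove the remaining volume terms.\<close>

lemma element_energy_balance:
  assumes forms: "\<gamma> > 1" "density_mean rbar" "density_flux_form rbar (f_vol s)"
      "tec_form K \<gamma> (f_vol s) \<or> etec_form K \<gamma> (f_vol s)" "noncons_flux_form rbar (g_vol s)"
    and lgl: "N \<ge> 1" "lgl_nodes N \<xi>"
    and geo: "metric_identities N \<xi> el" "conforming N el nb"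
    and adm: "\<And>i j k. i \<le> N \<Longrightarrow> j \<le> N \<Longrightarrow> k \<le> N \<Longrightarrow> admissible (u i j k)"
  shows "(\<Sum>i\<le>N. \<Sum>j\<le>N. \<Sum>k\<le>N.
      energy_gradient K \<gamma> (geopot el i j k) (u i j k) \<bullet> residual K \<gamma> s N \<xi> el nb u i j k)
    = interface_differences (energy_flux K \<gamma> (f_surf s) (g_surf s)) N \<xi> el nb u"
proof -
  define w where "w = quad_weight N \<xi>"
  define z where "z = (\<lambda>i j k. (u i j k, geopot el i j k))"
  define E where "E i j k = energy_gradient K \<gamma> (geopot el i j k) (u i j k)" for i j k
  define L1 where "L1 i j k = E i j k \<bullet> line_residual K \<gamma> s N \<xi> (\<lambda>m. z m j k) (\<lambda>m. metric el 1 m j k)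
           (nb_node nb Lower 1 j k) (nb_metric nb Lower 1 j k)
           (nb_node nb Upper 1 j k) (nb_metric nb Upper 1 j k) i" for i j k
  define L2 where "L2 i j k = E i j k \<bullet> line_residual K \<gamma> s N \<xi> (\<lambda>m. z i m k) (\<lambda>m. metric el 2 i m k)
           (nb_node nb Lower 2 i k) (nb_metric nb Lower 2 i k)
           (nb_node nb Upper 2 i k) (nb_metric nb Upper 2 i k) j" for i j k
  define L3 where "L3 i j k = E i j k \<bullet> line_residual K \<gamma> s N \<xi> (\<lambda>m. z i j m) (\<lambda>m. metric el 3 i j m)
           (nb_node nb Lower 3 i j) (nb_metric nb Lower 3 i j)
           (nb_node nb Upper 3 i j) (nb_metric nb Upper 3 i j) k" for i j k
  define F where "F x y A B = contract (\<lambda>d. energy_flux K \<gamma> (f_surf s) (g_surf s) d x y) (avg A B)"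
    for x y and A B :: "real^3"
  \<comment> \<open>\<open>M1\<close>, \<open>M2\<close>, \<open>M3\<close> are the three terms of the metric identities, and \<open>R\<close> is the flux potential
    contracted with one of them.\<close>
  define M1 where "M1 i j k = (\<Sum>m\<le>N. deriv_matrix N \<xi> i m *\<^sub>R metric el 1 m j k)" for i j k
  define M2 where "M2 i j k = (\<Sum>m\<le>N. deriv_matrix N \<xi> j m *\<^sub>R metric el 2 i m k)" for i j k
  define M3 where "M3 i j k = (\<Sum>m\<le>N. deriv_matrix N \<xi> k m *\<^sub>R metric el 3 i j m)" for i j k
  define R where "R M i j k = pressure K \<gamma> (u i j k) * (vel (u i j k) \<bullet> M i j k)" for M and i j k :: nat
  define F1 where "F1 a b = F (z 0 a b) (nb_node nb Lower 1 a b) (metric el 1 0 a b) (nb_metric nb Lower 1 a b)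
         - F (z N a b) (nb_node nb Upper 1 a b) (metric el 1 N a b) (nb_metric nb Upper 1 a b)" for a b
  define F2 where "F2 a b = F (z a 0 b) (nb_node nb Lower 2 a b) (metric el 2 a 0 b) (nb_metric nb Lower 2 a b)
         - F (z a N b) (nb_node nb Upper 2 a b) (metric el 2 a N b) (nb_metric nb Upper 2 a b)" for a b
  define F3 where "F3 a b = F (z a b 0) (nb_node nb Lower 3 a b) (metric el 3 a b 0) (nb_metric nb Lower 3 a b)
         - F (z a b N) (nb_node nb Upper 3 a b) (metric el 3 a b N) (nb_metric nb Upper 3 a b)" for a b
  note defs = E_def z_def F_def w_def R_def
  have line1: "(\<Sum>i\<le>N. L1 i j k) = F1 j k - (\<Sum>i\<le>N. w i * R M1 i j k)" if "j \<le> N" "k \<le> N" for j k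
    using line_energy_balance[where z = "\<lambda>m. z m j k" and A = "\<lambda>m. metric el 1 m j k"
        and aL = "nb_metric nb Lower 1 j k" and aR = "nb_metric nb Upper 1 j k" and \<xi> = \<xi>
        and zL = "nb_node nb Lower 1 j k" and zR = "nb_node nb Upper 1 j k", OF forms lgl]
      geo(2) adm that
    by (simp add: L1_def F1_def M1_def defs conforming_def)
  have line2: "(\<Sum>j\<le>N. L2 i j k) = F2 i k - (\<Sum>j\<le>N. w j * R M2 i j k)" if "i \<le> N" "k \<le> N" for i k
    using line_energy_balance[where z = "\<lambda>m. z i m k" and A = "\<lambda>m. metric el 2 i m k"
        and aL = "nb_metric nb Lower 2 i k" and aR = "nb_metric nb Upper 2 i k" and \<xi> = \<xi>
        and zL = "nb_node nb Lower 2 i k" and zR = "nb_node nb Upper 2 i k", OF forms lgl]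
      geo(2) adm that
    by (simp add: L2_def F2_def M2_def defs conforming_def)
  have line3: "(\<Sum>k\<le>N. L3 i j k) = F3 i j - (\<Sum>k\<le>N. w k * R M3 i j k)" if "i \<le> N" "j \<le> N" for i j
    using line_energy_balance[where z = "\<lambda>m. z i j m" and A = "\<lambda>m. metric el 3 i j m"
        and aL = "nb_metric nb Lower 3 i j" and aR = "nb_metric nb Upper 3 i j" and \<xi> = \<xi>
        and zL = "nb_node nb Lower 3 i j" and zR = "nb_node nb Upper 3 i j", OF forms lgl]
      geo(2) adm that
    by (simp add: L3_def F3_def M3_def defs conforming_def)
  have sum1: "(\<Sum>i\<le>N. \<Sum>j\<le>N. \<Sum>k\<le>N. w j * w k * L1 i j k)
      = (\<Sum>a\<le>N. \<Sum>b\<le>N. w a * w b * F1 a b) - (\<Sum>i\<le>N. \<Sum>j\<le>N. \<Sum>k\<le>N. w i * w j * w k * R M1 i j k)"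
    by (subst sum_rotate)
       (simp add: sum_distrib_left[symmetric] line1 right_diff_distrib sum_subtractf,
        subst sum_rotate, simp add: sum_distrib_left mult_ac)
  have sum2: "(\<Sum>i\<le>N. \<Sum>j\<le>N. \<Sum>k\<le>N. w i * w k * L2 i j k)
      = (\<Sum>a\<le>N. \<Sum>b\<le>N. w a * w b * F2 a b) - (\<Sum>i\<le>N. \<Sum>j\<le>N. \<Sum>k\<le>N. w i * w j * w k * R M2 i j k)"
    by (subst sum_swap_inner)
       (simp add: sum_distrib_left[symmetric] line2 right_diff_distrib sum_subtractf,
        subst sum_swap_inner, simp add: sum_distrib_left mult_ac)
  have sum3: "(\<Sum>i\<le>N. \<Sum>j\<le>N. \<Sum>k\<le>N. w i * w j * L3 i j k)
      = (\<Sum>a\<le>N. \<Sum>b\<le>N. w a * w b * F3 a b) - (\<Sum>i\<le>N. \<Sum>j\<le>N. \<Sum>k\<le>N. w i * w j * w k * R M3 i j k)"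
    by (simp add: sum_distrib_left[symmetric] line3 right_diff_distrib sum_subtractf)
       (simp add: sum_distrib_left mult_ac)
  have "R M1 i j k + R M2 i j k + R M3 i j k = 0" if "i \<le> N" "j \<le> N" "k \<le> N" for i j k
  proof -
    have "M1 i j k + M2 i j k + M3 i j k = 0"
      using geo(1) that by (simp add: metric_identities_def M1_def M2_def M3_def)
    then have "vel (u i j k) \<bullet> M1 i j k + vel (u i j k) \<bullet> M2 i j k + vel (u i j k) \<bullet> M3 i j k = 0"
      by (metis inner_add_right inner_zero_right)
    then show ?thesis unfolding R_def distrib_left[symmetric] by simp
  qed
  then have "(\<Sum>i\<le>N. \<Sum>j\<le>N. \<Sum>k\<le>N. w i * w j * w k * (R M1 i j k + R M2 i j k + R M3 i j k)) = 0"
    by simp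
  then have metric: "(\<Sum>i\<le>N. \<Sum>j\<le>N. \<Sum>k\<le>N. w i * w j * w k * R M1 i j k)
      + (\<Sum>i\<le>N. \<Sum>j\<le>N. \<Sum>k\<le>N. w i * w j * w k * R M2 i j k)
      + (\<Sum>i\<le>N. \<Sum>j\<le>N. \<Sum>k\<le>N. w i * w j * w k * R M3 i j k) = 0"
    by (simp add: distrib_left sum.distrib)
  have "E i j k \<bullet> residual K \<gamma> s N \<xi> el nb u i j k
      = w j * w k * L1 i j k + w i * w k * L2 i j k + w i * w j * L3 i j k" for i j k
    unfolding residual_def Let_def L1_def L2_def L3_def z_def w_def by (simp add: inner_add_right)
  then have "(\<Sum>i\<le>N. \<Sum>j\<le>N. \<Sum>k\<le>N. E i j k \<bullet> residual K \<gamma> s N \<xi> el nb u i j k)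
      = (\<Sum>i\<le>N. \<Sum>j\<le>N. \<Sum>k\<le>N. w j * w k * L1 i j k)
      + (\<Sum>i\<le>N. \<Sum>j\<le>N. \<Sum>k\<le>N. w i * w k * L2 i j k)
      + (\<Sum>i\<le>N. \<Sum>j\<le>N. \<Sum>k\<le>N. w i * w j * L3 i j k)"
    by (simp add: sum.distrib)
  also have "\<dots> = (\<Sum>a\<le>N. \<Sum>b\<le>N. w a * w b * (F1 a b + F2 a b + F3 a b))"
    using metric unfolding sum1 sum2 sum3 by (simp add: distrib_left sum.distrib)
  also have "\<dots> = interface_differences (energy_flux K \<gamma> (f_surf s) (g_surf s)) N \<xi> el nb u"
    unfolding interface_differences_def Let_def F1_def F2_def F3_def F_def z_def w_def
    by (simp add: algebra_simps)
  finally show ?thesis unfolding E_def .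
qed

text \<open>The chain rule for the nodal total energy; the geopotential does not depend on time.\<close>

lemma total_energy_rate:
  assumes "(u has_vector_derivative u') (at t)" "admissible (u t)"
  shows "((\<lambda>\<tau>. total_energy K \<gamma> \<phi> (u \<tau>)) has_real_derivative energy_gradient K \<gamma> \<phi> (u t) \<bullet> u') (at t)"
proof -
  have "((\<lambda>\<tau>. total_energy K \<gamma> \<phi> (u \<tau>)) has_derivative
      (\<lambda>h. (h *\<^sub>R u') \<bullet> energy_gradient K \<gamma> \<phi> (u t))) (at t)"
    using has_derivative_compose[OF assms(1)[unfolded has_vector_derivative_def]
        gderiv_total_energy[OF assms(2), unfolded gderiv_def]] .
  then show ?thesis
    by (simp add: has_field_derivative_def inner_commute mult.commute mult_commute_abs)
qed

theorem theorem6p1: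
  fixes K \<gamma> :: real and rbar :: "state \<Rightarrow> state \<Rightarrow> real" and s :: scheme
  assumes "K > 0" and "\<gamma> > 1"
    and "density_mean rbar"
    and "density_flux_form rbar (f_surf s)" and "density_flux_form rbar (f_vol s)"
    and "noncons_flux_form rbar (g_surf s)" and "noncons_flux_form rbar (g_vol s)"
    and "tec_form K \<gamma> (f_vol s) \<or> etec_form K \<gamma> (f_vol s)"
    and "tec_form K \<gamma> (f_surf s) \<or> etec_form K \<gamma> (f_surf s)"
  shows "total_energy_conservative K \<gamma> s"
  unfolding total_energy_conservative_def
proof (intro exI conjI allI impI)
  let ?F = "energy_flux K \<gamma> (f_surf s) (g_surf s)"
  show "numerical_energy_flux K \<gamma> ?F"
    unfolding numerical_energy_flux_def
    using energy_flux_symmetric[OF assms(2,3,4,9,6)] energy_flux_consistent(1)[OF assms(2,3,4,9,6)]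
    by blast
  fix N \<xi> el nb and u :: "real \<Rightarrow> nat \<Rightarrow> nat \<Rightarrow> nat \<Rightarrow> state" and t
  assume N: "1 \<le> N" and lgl: "lgl_nodes N \<xi>" and geo: "element_geometry N \<xi> el nb"
    and adm: "admissible_data N nb (u t)" and sol: "solves_at K \<gamma> s N \<xi> el nb u t"
  let ?E = "\<lambda>i j k. energy_gradient K \<gamma> (geopot el i j k) (u t i j k)"
  let ?r = "residual K \<gamma> s N \<xi> el nb (u t)"
  have adm': "admissible (u t i j k)" if "i \<le> N" "j \<le> N" "k \<le> N" for i j k
    using adm that unfolding admissible_data_def by blast
  have balance: "(\<Sum>i\<le>N. \<Sum>j\<le>N. \<Sum>k\<le>N. ?E i j k \<bullet> ?r i j k)
      = interface_differences ?F N \<xi> el nb (u t)"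
    using geo adm' unfolding element_geometry_def
    by (intro element_energy_balance[OF assms(2,3,5,8,7) N lgl]) auto
  then show "(\<Sum>i\<le>N. \<Sum>j\<le>N. \<Sum>k\<le>N.
             entropy_vars K \<gamma> (geopot el i j k) (u t i j k) \<bullet> ?r i j k)
            = interface_differences ?F N \<xi> el nb (u t)"
    by (simp add: entropy_vars_eq adm')
  have "((\<lambda>\<tau>. nodal_mass N \<xi> el i j k * total_energy K \<gamma> (geopot el i j k) (u \<tau> i j k))
      has_real_derivative ?E i j k \<bullet> ?r i j k) (at t)"
    if le: "i \<le> N" "j \<le> N" "k \<le> N" for i j k
  proof -
    obtain u' where u': "((\<lambda>\<tau>. u \<tau> i j k) has_vector_derivative u') (at t)"
        "nodal_mass N \<xi> el i j k *\<^sub>R u' = ?r i j k"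
      using sol le unfolding solves_at_def by blast
    show ?thesis
      unfolding u'(2)[symmetric] inner_scaleR_right
      by (intro DERIV_cmult total_energy_rate u'(1) adm' le)
  qed
  then show "((\<lambda>\<tau>. \<Sum>i\<le>N. \<Sum>j\<le>N. \<Sum>k\<le>N.
               nodal_mass N \<xi> el i j k * total_energy K \<gamma> (geopot el i j k) (u \<tau> i j k))
             has_real_derivative interface_differences ?F N \<xi> el nb (u t)) (at t)"
    unfolding balance[symmetric] by (intro DERIV_sum) auto
qed

end
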